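(* Let $n$ be an arbitrary positive integer and $\lambda$ be an arbitrary infinite cardinal. Then every semiregular feebly compact $T_1$-topology $\tau$ on $\exp_n\lambda$ such that $(\exp_n\lambda,\tau)$ is a semitopological semilattice is compact, and hence the semilattice operation in $(\exp_n\lambda,\tau)$ is (jointly) continuous.
   Context: For a positive integer $n$ and a non-zero cardinal $\lambda$, $\exp_n\lambda=\{A\subseteq\lambda : |A|\leqslant n\}$, regarded as a semilattice with operation $\cap$. A semitopological semilattice is a topological space together with a separately continuous semilattice operation. A subset $A$ of a topological space $X$ is regular open if $\operatorname{int}_X(\operatorname{cl}_X(A))=A$. A space is semiregular if it has a base consisting of regular open subsets. A space is feebly compact if each locally finite open cover of it is finite. A space is compact if each open cover has a finite subcover. A topology is called compact, feebly compact, etc., if the corresponding space is. *)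

theory Defs
  imports "HOL-Analysis.Analysis"
begin

(* The cardinal is represented by an arbitrary set L of that cardinality. The conjunct
   "finite A" is needed because card is 0 on infinite sets. *)
definition exp_sets :: "nat \<Rightarrow> 'a set \<Rightarrow> 'a set set" where
  "exp_sets n L = {A. A \<subseteq> L \<and> finite A \<and> card A \<le> n}"

definition semilattice_on :: "'b set \<Rightarrow> ('b \<Rightarrow> 'b \<Rightarrow> 'b) \<Rightarrow> bool" where
  "semilattice_on S f \<longleftrightarrow>
     (\<forall>x\<in>S. \<forall>y\<in>S. f x y \<in> S) \<and>
     (\<forall>x\<in>S. \<forall>y\<in>S. \<forall>z\<in>S. f (f x y) z = f x (f y z)) \<and>
     (\<forall>x\<in>S. \<forall>y\<in>S. f x y = f y x) \<and>
     (\<forall>x\<in>S. f x x = x)"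

definition semitopological_semilattice :: "'b topology \<Rightarrow> ('b \<Rightarrow> 'b \<Rightarrow> 'b) \<Rightarrow> bool" where
  "semitopological_semilattice X f \<longleftrightarrow>
     semilattice_on (topspace X) f \<and>
     (\<forall>a\<in>topspace X. continuous_map X X (\<lambda>x. f a x) \<and> continuous_map X X (\<lambda>x. f x a))"

definition regular_open_in :: "'b topology \<Rightarrow> 'b set \<Rightarrow> bool" where
  "regular_open_in X A \<longleftrightarrow> A \<subseteq> topspace X \<and> X interior_of (X closure_of A) = A"

definition semiregular_space :: "'b topology \<Rightarrow> bool" where
  "semiregular_space X \<longleftrightarrow>
     (\<exists>\<B>. (\<forall>U\<in>\<B>. regular_open_in X U) \<and> openin X = arbitrary union_of (\<lambda>U. U \<in> \<B>))"

definition feebly_compact_space :: "'b topology \<Rightarrow> bool" where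
  "feebly_compact_space X \<longleftrightarrow>
     (\<forall>\<U>. (\<forall>U\<in>\<U>. openin X U) \<and> \<Union>\<U> = topspace X \<and> locally_finite_in X \<U> \<longrightarrow> finite \<U>)"

lemma semilattice_on_exp_sets: "semilattice_on (exp_sets n L) (\<inter>)"
  unfolding semilattice_on_def exp_sets_def
  by (auto intro: le_trans[OF card_mono[OF _ Int_lower1]])

end

theory Submission
  imports Defs
begin

text \<open>
  Call the set of all \<open>B\<close> with \<open>A \<subseteq> B\<close> and \<open>B \<inter> F = {}\<close>, for finite \<open>A\<close> and \<open>F\<close>, a cylinder.
  The cylinders form a base of the topology that \<open>exp\<^sub>n \<lambda>\<close> inherits from the Cantor cube
  \<open>2\<^sup>\<lambda>\<close>, a compact topology with continuous intersection. The theorem holds because \<open>\<tau>\<close>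
  is this topology.

  That cylinders are \<open>\<tau>\<close>-open follows from separate continuity and \<open>T\<^sub>1\<close>: the translation
  \<open>B \<mapsto> B \<inter> {a}\<close> has just two values, so both of its fibres are clopen.

  The converse, \<open>regular_open_contains_cylinder\<close>, is the heart of the proof. Let \<open>U\<close> be a regular
  open neighbourhood of \<open>x\<close> and \<open>V\<close> the complement of its closure. If no cylinder around \<open>x\<close>
  lay inside \<open>U\<close>, there would be points \<open>y \<supseteq> x\<close> outside \<open>U\<close> avoiding any prescribed
  finite set disjoint from \<open>x\<close>. By regular openness, such a \<open>y\<close> is in the closure of \<open>V\<close>, so
  every cylinder around \<open>y\<close> meets \<open>V\<close>, and a point of largest cardinality in the
  intersection is isolated. This produces infinitely many isolated points of \<open>V\<close> above \<open>x\<close> that are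
  pairwise disjoint off \<open>x\<close>. Such points accumulate nowhere but at \<open>x\<close>, and not at \<open>x\<close>
  either, since \<open>U\<close> misses \<open>V\<close>; this contradicts feeble compactness.

  Compactness then follows by downward induction on \<open>card x\<close>, applied to the set of points above
  \<open>x\<close>: one member of the cover contains \<open>x\<close> and leaves uncovered only points above finitely many
  sets \<open>x \<union> {a}\<close>. Joint continuity is read off from cylinders.
\<close>

section \<open>Feeble compactness and local finiteness\<close>

text \<open>Adding the whole space turns any locally finite family of open sets into a cover without
  affecting local finiteness.\<close>

lemma feebly_compact_space_finite_family:
  assumes "feebly_compact_space X" "\<And>U. U \<in> \<U> \<Longrightarrow> openin X U" "locally_finite_in X \<U>"
  shows "finite \<U>"
proof -
  let ?\<U> = "insert (topspace X) \<U>"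
  have "locally_finite_in X ?\<U>"
    unfolding locally_finite_in_def
  proof (intro conjI ballI)
    show "\<Union>?\<U> \<subseteq> topspace X"
      using assms(2) openin_subset by blast
  next
    fix p assume "p \<in> topspace X"
    then obtain V where V: "openin X V" "p \<in> V" "finite {U \<in> \<U>. U \<inter> V \<noteq> {}}"
      using assms(3) unfolding locally_finite_in_def by meson
    have "finite {U \<in> ?\<U>. U \<inter> V \<noteq> {}}"
      by (rule finite_subset[of _ "insert (topspace X) {U \<in> \<U>. U \<inter> V \<noteq> {}}"]) (use V in auto)
    then show "\<exists>V. openin X V \<and> p \<in> V \<and> finite {U \<in> ?\<U>. U \<inter> V \<noteq> {}}"
      using V by blast
  qed
  moreover have "\<forall>U\<in>?\<U>. openin X U" "\<Union>?\<U> = topspace X"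
    using assms(2) openin_subset by blast+
  ultimately have "finite ?\<U>"
    using assms(1) unfolding feebly_compact_space_def by (metis (no_types, lifting))
  then show ?thesis by simp
qed

section \<open>Cylinders\<close>

definition cylinder :: "nat \<Rightarrow> 'a set \<Rightarrow> 'a set \<Rightarrow> 'a set \<Rightarrow> 'a set set" where
  "cylinder n L A F = {B \<in> exp_sets n L. A \<subseteq> B \<and> B \<inter> F = {}}"

locale t1_semitopological_exp =
  fixes n :: nat and L :: "'a set" and \<tau> :: "'a set topology"
  assumes n_pos: "n > 0"
    and topspace_eq: "topspace \<tau> = exp_sets n L"
    and t1: "t1_space \<tau>"
    and semitopological: "semitopological_semilattice \<tau> (\<inter>)"
begin

lemma openin_member_and_nonmember:
  shows "openin \<tau> {B \<in> exp_sets n L. a \<in> B}" "openin \<tau> {B \<in> exp_sets n L. a \<notin> B}"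
proof -
  let ?In = "{B \<in> exp_sets n L. a \<in> B}" and ?Out = "{B \<in> exp_sets n L. a \<notin> B}"
  have "openin \<tau> ?In \<and> openin \<tau> ?Out"
  proof (cases "a \<in> L")
    case False
    then have "?In = {}" "?Out = topspace \<tau>"
      by (auto simp: exp_sets_def topspace_eq)
    then show ?thesis by (simp only: openin_empty openin_topspace)
  next
    case True
    have pts: "{a} \<in> exp_sets n L" "{} \<in> exp_sets n L"
      using True n_pos by (auto simp: exp_sets_def)
    then have cont: "continuous_map \<tau> \<tau> (\<lambda>B. {a} \<inter> B)"
      using semitopological unfolding semitopological_semilattice_def topspace_eq by blast
    have closed: "closedin \<tau> {B \<in> topspace \<tau>. {a} \<inter> B \<in> {c}}" if "c \<in> exp_sets n L" for c
      using that t1 topspace_eq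
      by (intro closedin_continuous_map_preimage[OF cont]) (simp add: closedin_t1_singleton)
    have "?In = {B \<in> topspace \<tau>. {a} \<inter> B \<in> {{a}}}" "?Out = {B \<in> topspace \<tau>. {a} \<inter> B \<in> {{}}}"
      by (auto simp: topspace_eq)
    then have "closedin \<tau> ?In" "closedin \<tau> ?Out"
      using closed[OF pts(1)] closed[OF pts(2)] by (simp_all only:)
    then have "openin \<tau> (topspace \<tau> - ?Out)" "openin \<tau> (topspace \<tau> - ?In)"
      by (simp_all only: openin_diff openin_topspace)
    moreover have "topspace \<tau> - ?Out = ?In" "topspace \<tau> - ?In = ?Out"
      by (auto simp: topspace_eq)
    ultimately show ?thesis by (simp only:)
  qed
  then show "openin \<tau> ?In" and "openin \<tau> ?Out"
    by (rule conjunct1, rule conjunct2)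
qed

lemma openin_cylinder:
  assumes "finite A" "finite F"
  shows "openin \<tau> (cylinder n L A F)"
proof -
  have "openin \<tau> (\<Inter> (insert (topspace \<tau>) ((\<lambda>a. {B \<in> exp_sets n L. a \<in> B}) ` A \<union>
                                        (\<lambda>a. {B \<in> exp_sets n L. a \<notin> B}) ` F)))"
    using assms openin_member_and_nonmember by (intro openin_Inter) auto
  also have "\<dots> = cylinder n L A F"
    by (auto simp: cylinder_def topspace_eq)
  finally show ?thesis .
qed

text \<open>A member \<open>z\<close> of largest cardinality is the only member above \<open>z\<close>, and the points above
  \<open>z\<close> form an open set.\<close>

lemma nonempty_open_contains_isolated:
  assumes "openin \<tau> W" "W \<noteq> {}"
  obtains z where "z \<in> W" "openin \<tau> {z}"
proof -
  have W: "W \<subseteq> exp_sets n L"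
    using assms(1) openin_subset topspace_eq by metis
  have bounded: "\<forall>B. B \<in> W \<longrightarrow> card B < Suc n"
    using W by (auto simp: exp_sets_def)
  obtain z0 where "z0 \<in> W" using assms(2) by blast
  from ex_has_greatest_nat[of "\<lambda>B. B \<in> W", OF this bounded]
  obtain z where z: "z \<in> W" and max: "\<And>B. B \<in> W \<Longrightarrow> card B \<le> card z" by blast
  have fin: "finite B" if "B \<in> W" for B
    using that W by (auto simp: exp_sets_def)
  have "W \<inter> cylinder n L z {} = {z}"
  proof (intro equalityI subsetI)
    fix B assume "B \<in> W \<inter> cylinder n L z {}"
    then have "B \<in> W" "z \<subseteq> B" by (auto simp: cylinder_def)
    then show "B \<in> {z}"
      using card_seteq[OF fin[of B]] max by blast
  next
    fix B assume "B \<in> {z}"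
    then show "B \<in> W \<inter> cylinder n L z {}"
      using z W by (auto simp: cylinder_def)
  qed
  moreover have "openin \<tau> (W \<inter> cylinder n L z {})"
    using assms(1) openin_cylinder fin[OF z] by blast
  ultimately show ?thesis using that z by simp
qed

section \<open>Regular open neighbourhoods contain cylinders\<close>

text \<open>Two members of \<open>M\<close> share no point outside \<open>x\<close>. Hence a point different from \<open>x\<close> has a
  cylinder meeting at most one member, and \<open>x\<close> itself is separated from \<open>M\<close> by \<open>U\<close>.\<close>

lemma finite_isolated_star:
  assumes "feebly_compact_space \<tau>"
    and U: "openin \<tau> U" "x \<in> U" "U \<inter> M = {}"
    and isolated: "\<And>z. z \<in> M \<Longrightarrow> openin \<tau> {z}"
    and above: "\<And>z. z \<in> M \<Longrightarrow> x \<subseteq> z"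
    and disj: "pairwise (\<lambda>z w. disjnt (z - x) (w - x)) M"
  shows "finite M"
proof -
  let ?\<U> = "(\<lambda>z. {z}) ` M"
  have M_subset: "M \<subseteq> topspace \<tau>"
    using isolated openin_subset by blast
  have few: "\<exists>V. openin \<tau> V \<and> p \<in> V \<and> finite (M \<inter> V)" if p: "p \<in> topspace \<tau>" for p
  proof -
    consider "p = x" | a where "a \<in> x" "a \<notin> p" | a where "a \<in> p" "a \<notin> x" by blast
    then show ?thesis
    proof cases
      case 1
      then show ?thesis
        using U by (metis Int_commute finite.emptyI)
    next
      case 2
      then have "M \<inter> {B \<in> exp_sets n L. a \<notin> B} = {}"
        using above by blast
      then show ?thesis
        using 2 p openin_member_and_nonmember(2) topspace_eq
        by (metis (mono_tags, lifting) finite.emptyI mem_Collect_eq)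
    next
      case 3
      let ?V = "{B \<in> exp_sets n L. a \<in> B}"
      have unique: "z = w" if "z \<in> M \<inter> ?V" "w \<in> M \<inter> ?V" for z w
      proof (rule ccontr)
        assume "z \<noteq> w"
        then have "disjnt (z - x) (w - x)"
          using that disj by (auto dest: pairwiseD)
        then show False
          using that 3 by (auto simp: disjnt_iff)
      qed
      have "finite (M \<inter> ?V)"
      proof (cases "M \<inter> ?V = {}")
        case False
        then obtain z where "z \<in> M \<inter> ?V" by blast
        then have "M \<inter> ?V \<subseteq> {z}" using unique by blast
        then show ?thesis by (rule finite_subset) simp
      qed simp
      then show ?thesis
        using 3 p openin_member_and_nonmember(1) topspace_eq by blast
    qed
  qed
  have "locally_finite_in \<tau> ?\<U>"
    unfolding locally_finite_in_def
  proof (intro conjI ballI)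
    show "\<Union>?\<U> \<subseteq> topspace \<tau>" using M_subset by blast
  next
    fix p assume "p \<in> topspace \<tau>"
    then obtain V where V: "openin \<tau> V" "p \<in> V" "finite (M \<inter> V)" using few by blast
    have "{S \<in> ?\<U>. S \<inter> V \<noteq> {}} = (\<lambda>z. {z}) ` (M \<inter> V)" by auto
    then have "finite {S \<in> ?\<U>. S \<inter> V \<noteq> {}}" using V by simp
    then show "\<exists>V. openin \<tau> V \<and> p \<in> V \<and> finite {S \<in> ?\<U>. S \<inter> V \<noteq> {}}"
      using V by blast
  qed
  then have "finite ?\<U>"
    by (rule feebly_compact_space_finite_family[OF assms(1), rotated]) (use isolated in auto)
  then show ?thesis
    by (rule finite_imageD) simp
qed

text \<open>The excluded set \<open>F\<close> is what a maximal family of isolated points, disjoint off \<open>x\<close>, covers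
  outside \<open>x\<close>: a point of the cylinder outside \<open>U\<close> would yield one more member.\<close>

lemma regular_open_contains_cylinder:
  assumes fc: "feebly_compact_space \<tau>" and reg: "regular_open_in \<tau> U" and x: "x \<in> U"
  obtains F where "finite F" "F \<inter> x = {}" "cylinder n L x F \<subseteq> U"
proof -
  have U_eq: "\<tau> interior_of (\<tau> closure_of U) = U" and U_sub: "U \<subseteq> topspace \<tau>"
    using reg by (auto simp: regular_open_in_def)
  have U_open: "openin \<tau> U"
    using openin_interior_of[of \<tau> "\<tau> closure_of U"] unfolding U_eq .
  define V where "V = topspace \<tau> - \<tau> closure_of U"
  have V_open: "openin \<tau> V"
    unfolding V_def by (intro openin_diff openin_topspace closedin_closure_of)
  have UV: "U \<inter> V = {}"
    using closure_of_subset[OF U_sub] by (auto simp: V_def)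
  define good where "good M \<longleftrightarrow> M \<subseteq> {z \<in> V. openin \<tau> {z} \<and> x \<subseteq> z} \<and>
                                 pairwise (\<lambda>z w. disjnt (z - x) (w - x)) M" for M
  have "\<exists>M\<in>Collect good. \<forall>N\<in>Collect good. M \<subseteq> N \<longrightarrow> N = M"
  proof (rule subset_Zorn')
    fix C assume C: "subset.chain (Collect good) C"
    have good: "good N" if "N \<in> C" for N
      using C that by (auto simp: subset_chain_def)
    have "chain\<^sub>\<subseteq> C"
      using C by (auto simp: subset_chain_def chain_subset_def)
    then have "pairwise (\<lambda>z w. disjnt (z - x) (w - x)) (\<Union>C)"
      using good by (intro pairwise_chain_Union) (simp_all add: good_def)
    moreover have "\<Union>C \<subseteq> {z \<in> V. openin \<tau> {z} \<and> x \<subseteq> z}"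
      using good by (intro Union_least) (simp add: good_def)
    ultimately show "\<Union>C \<in> Collect good"
      by (simp add: good_def)
  qed
  then obtain M where M: "good M" and maximal: "\<And>N. good N \<Longrightarrow> M \<subseteq> N \<Longrightarrow> N = M"
    unfolding Bex_def Ball_def mem_Collect_eq by metis
  have M_V: "M \<subseteq> V" and isolated: "\<And>z. z \<in> M \<Longrightarrow> openin \<tau> {z}"
    and above: "\<And>z. z \<in> M \<Longrightarrow> x \<subseteq> z"
    and disj: "pairwise (\<lambda>z w. disjnt (z - x) (w - x)) M"
    using M unfolding good_def by blast+
  have "U \<inter> M = {}" using UV M_V by blast
  from finite_isolated_star[OF fc U_open x this isolated above disj] have "finite M" .
  define F where "F = \<Union>M - x"
  have fin_pts: "finite B" if "B \<in> topspace \<tau>" for B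
    using that by (simp add: topspace_eq exp_sets_def)
  have "finite (\<Union>M)"
  proof (rule finite_Union[OF \<open>finite M\<close>])
    fix B assume "B \<in> M"
    then have "B \<in> topspace \<tau>" using openin_subset[OF isolated] by simp
    then show "finite B" by (rule fin_pts)
  qed
  then have "finite F"
    unfolding F_def by (rule finite_Diff)
  moreover have "cylinder n L x F \<subseteq> U"
  proof (rule subsetI, rule ccontr)
    fix y assume y: "y \<in> cylinder n L x F" and "y \<notin> U"
    let ?W = "V \<inter> cylinder n L y F"
    have y_top: "y \<in> topspace \<tau>"
      using y by (simp add: cylinder_def topspace_eq)
    have cyl: "openin \<tau> (cylinder n L y F)" "y \<in> cylinder n L y F"
      using y openin_cylinder[OF fin_pts[OF y_top] \<open>finite F\<close>] by (auto simp: cylinder_def)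
    have "\<not> cylinder n L y F \<subseteq> \<tau> closure_of U"
    proof
      assume "cylinder n L y F \<subseteq> \<tau> closure_of U"
      from interior_of_maximal[OF this cyl(1)] show False
        using cyl(2) \<open>y \<notin> U\<close> U_eq by auto
    qed
    then have "?W \<noteq> {}"
      using openin_subset[OF cyl(1)] by (auto simp: V_def)
    then obtain z where z: "z \<in> ?W" "openin \<tau> {z}"
      using nonempty_open_contains_isolated[OF openin_Int[OF V_open cyl(1)]] by metis
    have xz: "x \<subseteq> z" and zF: "z \<inter> F = {}"
      using z y by (auto simp: cylinder_def)
    have "z \<noteq> x" using z x UV by blast
    have "pairwise (\<lambda>z w. disjnt (z - x) (w - x)) (insert z M)"
    proof (rule pairwiseI)
      fix v w assume "v \<in> insert z M" "w \<in> insert z M" "v \<noteq> w"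
      moreover have "disjnt (z - x) (m - x)" if "m \<in> M" for m
        using that zF unfolding F_def disjnt_iff by blast
      ultimately show "disjnt (v - x) (w - x)"
        using disj by (metis disjnt_sym insertE pairwiseD)
    qed
    then have "good (insert z M)"
      using M z xz by (simp add: good_def)
    from maximal[OF this] have "z \<in> M" by blast
    then have "z - x \<subseteq> F" by (auto simp: F_def)
    then show False
      using zF xz \<open>z \<noteq> x\<close> by blast
  qed
  moreover have "F \<inter> x = {}" by (auto simp: F_def)
  ultimately show ?thesis using that by blast
qed

lemma open_contains_cylinder:
  assumes "feebly_compact_space \<tau>" "semiregular_space \<tau>" "openin \<tau> W" "x \<in> W"
  obtains F where "finite F" "F \<inter> x = {}" "cylinder n L x F \<subseteq> W"
proof -
  obtain \<B> where \<B>: "\<forall>U\<in>\<B>. regular_open_in \<tau> U" "openin \<tau> = arbitrary union_of (\<lambda>U. U \<in> \<B>)"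
    using assms(2) by (auto simp: semiregular_space_def)
  then obtain U where "regular_open_in \<tau> U" "x \<in> U" "U \<subseteq> W"
    using assms(3,4) by (auto simp: union_of_def arbitrary_def)
  then show ?thesis
    using regular_open_contains_cylinder[OF assms(1)] that by (metis subset_trans)
qed

section \<open>Compactness and joint continuity\<close>

text \<open>Downward induction on \<open>card x\<close>, with \<open>n - card x\<close> as the measure. A neighbourhood of \<open>x\<close>
  contains all points above \<open>x\<close> but those above one of finitely many \<open>insert a x\<close>; these larger
  sets either are points, with a compact set of points above them, or are below no point at all.\<close>

lemma compactin_above:
  assumes "feebly_compact_space \<tau>" "semiregular_space \<tau>"
  shows "x \<in> exp_sets n L \<Longrightarrow> compactin \<tau> (cylinder n L x {})"
proof (induction "n - card x" arbitrary: x rule: less_induct)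
  case less
  have fin: "finite x" using less.prems by (simp add: exp_sets_def)
  have step: "compactin \<tau> (cylinder n L (insert a x) {})" if "a \<notin> x" for a
  proof (cases "insert a x \<in> exp_sets n L")
    case True
    then have "Suc (card x) \<le> n" "card (insert a x) = Suc (card x)"
      using that fin by (simp_all add: exp_sets_def)
    then have "n - card (insert a x) < n - card x" by linarith
    then show ?thesis using less.hyps True by blast
  next
    case False
    have "cylinder n L (insert a x) {} = {}"
    proof (rule equals0I)
      fix B assume "B \<in> cylinder n L (insert a x) {}"
      then have B: "insert a x \<subseteq> B" "B \<subseteq> L" "finite B" "card B \<le> n"
        by (auto simp: cylinder_def exp_sets_def)
      then have "card (insert a x) \<le> n"
        using card_mono[OF B(3,1)] by linarith
      with B fin have "insert a x \<in> exp_sets n L" by (auto simp: exp_sets_def)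
      with False show False by blast
    qed
    then show ?thesis by simp
  qed
  show ?case
    unfolding compactin_def
  proof (intro conjI allI impI)
    show "cylinder n L x {} \<subseteq> topspace \<tau>"
      by (auto simp: cylinder_def topspace_eq)
  next
    fix \<U> assume \<U>: "Ball \<U> (openin \<tau>) \<and> cylinder n L x {} \<subseteq> \<Union>\<U>"
    have "x \<in> cylinder n L x {}" using less.prems by (simp add: cylinder_def)
    then obtain U where U: "U \<in> \<U>" "x \<in> U" using \<U> by blast
    have "openin \<tau> U" using U \<U> by blast
    from open_contains_cylinder[OF assms this U(2)]
    obtain F where F: "finite F" "F \<inter> x = {}" "cylinder n L x F \<subseteq> U" .
    let ?R = "\<Union>a\<in>F. cylinder n L (insert a x) {}"
    have "compactin \<tau> ?R"
      using F step by (intro compactin_Union) auto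
    moreover have "?R \<subseteq> cylinder n L x {}"
      by (auto simp: cylinder_def)
    then have "?R \<subseteq> \<Union>\<U>"
      using conjunct2[OF \<U>] by (rule subset_trans)
    ultimately obtain \<F> where \<F>: "finite \<F>" "\<F> \<subseteq> \<U>" "?R \<subseteq> \<Union>\<F>"
      using compactinD[of \<tau> ?R \<U>] \<U> by metis
    have "cylinder n L x {} \<subseteq> cylinder n L x F \<union> ?R"
      by (auto simp: cylinder_def)
    also have "\<dots> \<subseteq> \<Union>(insert U \<F>)"
      using Un_mono[OF F(3) \<F>(3)] by (simp only: Union_insert)
    finally show "\<exists>\<F>. finite \<F> \<and> \<F> \<subseteq> \<U> \<and> cylinder n L x {} \<subseteq> \<Union>\<F>"
      using \<F> U by (intro exI[of _ "insert U \<F>"]) simp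
  qed
qed

lemma compact_space:
  assumes "feebly_compact_space \<tau>" "semiregular_space \<tau>"
  shows "compact_space \<tau>"
proof -
  have "cylinder n L {} {} = topspace \<tau>"
    by (auto simp: cylinder_def topspace_eq)
  then show ?thesis
    using compactin_above[OF assms, of "{}"] by (simp add: compact_space_def exp_sets_def)
qed

text \<open>The cylinder of \<open>A \<inter> B\<close> excluding \<open>F\<close> contains all intersections of a member of the cylinder of
  \<open>A\<close> excluding \<open>F - A\<close> with a member of the cylinder of \<open>B\<close> excluding \<open>F - B\<close>: as \<open>F\<close> is disjoint
  from \<open>A \<inter> B\<close>, each of its elements is excluded on at least one side.\<close>

lemma continuous_map_Int:
  assumes "feebly_compact_space \<tau>" "semiregular_space \<tau>"
  shows "continuous_map (prod_topology \<tau> \<tau>) \<tau> (\<lambda>(A, B). A \<inter> B)"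
proof -
  have closed: "A \<inter> B \<in> exp_sets n L" if "A \<in> exp_sets n L" "B \<in> exp_sets n L" for A B
    using that semilattice_on_exp_sets[of n L] by (simp add: semilattice_on_def)
  have "openin (prod_topology \<tau> \<tau>) {p \<in> topspace (prod_topology \<tau> \<tau>). (\<lambda>(A, B). A \<inter> B) p \<in> W}"
    (is "openin _ ?P") if W: "openin \<tau> W" for W
    unfolding openin_prod_topology_alt
  proof (intro allI impI)
    fix A B assume AB: "(A, B) \<in> ?P"
    then have pts: "A \<in> exp_sets n L" "B \<in> exp_sets n L" and "A \<inter> B \<in> W"
      by (auto simp: topspace_eq)
    from open_contains_cylinder[OF assms W this(3)]
    obtain F where F: "finite F" "F \<inter> (A \<inter> B) = {}" "cylinder n L (A \<inter> B) F \<subseteq> W" .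
    let ?C = "cylinder n L A (F - A)" and ?D = "cylinder n L B (F - B)"
    have "openin \<tau> ?C" "openin \<tau> ?D"
      using pts F by (auto intro!: openin_cylinder simp: exp_sets_def)
    moreover have "A \<in> ?C" "B \<in> ?D"
      using pts by (auto simp: cylinder_def)
    moreover have "?C \<times> ?D \<subseteq> ?P"
    proof clarify
      fix S T assume ST: "S \<in> ?C" "T \<in> ?D"
      then have "S \<in> exp_sets n L" "T \<in> exp_sets n L" by (auto simp: cylinder_def)
      moreover from this ST have "S \<inter> T \<in> cylinder n L (A \<inter> B) F"
        using F(2) closed[of S T] by (auto simp: cylinder_def)
      ultimately show "(S, T) \<in> topspace (prod_topology \<tau> \<tau>) \<and> S \<inter> T \<in> W"
        using F(3) by (auto simp: topspace_eq)
    qed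
    ultimately show "\<exists>U V. openin \<tau> U \<and> openin \<tau> V \<and> A \<in> U \<and> B \<in> V \<and> U \<times> V \<subseteq> ?P"
      by blast
  qed
  moreover have "(\<lambda>(A, B). A \<inter> B) \<in> topspace (prod_topology \<tau> \<tau>) \<rightarrow> topspace \<tau>"
    using closed by (auto simp: topspace_eq)
  ultimately show ?thesis
    unfolding continuous_map_def by blast
qed

end

theorem theorem3:
  fixes n :: nat and L :: "'a set" and \<tau> :: "'a set topology"
  assumes "n > 0"
    and "infinite L"
    and "topspace \<tau> = exp_sets n L"
    and "semiregular_space \<tau>"
    and "feebly_compact_space \<tau>"
    and "t1_space \<tau>"
    and "semitopological_semilattice \<tau> (\<inter>)"
  shows "compact_space \<tau> \<and>
         continuous_map (prod_topology \<tau> \<tau>) \<tau> (\<lambda>(A, B). A \<inter> B)"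
proof -
  interpret t1_semitopological_exp n L \<tau>
    using assms by unfold_locales
  show ?thesis
    using compact_space continuous_map_Int assms by blast
qed

end
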